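(* Let $$B(z)=\int_z^{e^{-\frac{i\pi}{4}}\infty}e^{-i\zeta^2}\,d\zeta,\qquad z\in\mathbb{C},$$ and $$\hat K_0(z)=-\frac{e^{\frac{i\pi}{4}}}{2\sqrt{\pi}}\int_{-\infty}^{\infty}\frac{e^{-\frac12\zeta^2}}{\zeta+\sqrt{2}\,e^{-\frac{\pi i}{4}}z}\,d\zeta,\qquad z\in\mathbb{C}\setminus e^{\frac{i\pi}{4}}\mathbb{R}.$$ Then $$B(z)=\begin{cases} e^{-iz^2}\hat K_0(z), & \operatorname{Im}\left(e^{-\frac{i\pi}{4}}z\right)<0,\\[4pt] e^{-iz^2}\hat K_0(z)+\sqrt{\pi}\,e^{-\frac{i\pi}{4}}, & \operatorname{Im}\left(e^{-\frac{i\pi}{4}}z\right)>0.\end{cases}$$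
   Context: The integral defining $B(z)$ is a contour integral of the entire function $e^{-i\zeta^2}$ from $z$ to infinity in the direction $e^{-i\pi/4}$. The integral defining $\hat K_0(z)$ is over the real line. *)

theory Defs
  imports "HOL-Complex_Analysis.Complex_Analysis"
begin

text \<open>Improper contour integral of \<open>f\<close> from \<open>z\<close> to infinity in the direction \<open>d\<close>, taken along
  the ray \<open>z + R d\<close>, \<open>R \<ge> 0\<close>.\<close>

definition ray_integral :: "(complex \<Rightarrow> complex) \<Rightarrow> complex \<Rightarrow> complex \<Rightarrow> complex" where
  "ray_integral f z d =
     Lim at_top (\<lambda>R::real. contour_integral (linepath z (z + of_real R * d)) f)"

definition B :: "complex \<Rightarrow> complex" where
  "B z = ray_integral (\<lambda>\<zeta>. exp (- \<i> * \<zeta>\<^sup>2)) z (exp (- (\<i> * of_real pi / 4)))"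

text \<open>The integral converges (absolutely) exactly when \<open>z\<close> is off the line
  \<open>exp (\<i> * pi / 4) * \<real>\<close>; on that line \<open>K0_hat\<close> has no mathematical meaning.\<close>

definition K0_hat :: "complex \<Rightarrow> complex" where
  "K0_hat z = - (exp (\<i> * of_real pi / 4) / (2 * of_real (sqrt pi))) *
     (LINT \<zeta>|lborel. of_real (exp (- (1 / 2) * \<zeta>\<^sup>2)) /
        (of_real \<zeta> + of_real (sqrt 2) * exp (- (of_real pi * \<i> / 4)) * z))"

end

theory Submission
  imports Defs "HOL-Probability.Characteristic_Functions"
begin

text \<open>
  Put \<open>\<omega> = exp (-i \<pi>/4)\<close>, so that \<open>\<omega>\<^sup>2 = -i\<close>, and \<open>w = sqrt 2 \<omega> z\<close>. Both sides are expressed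
  through the single function \<open>H(w) = \<integral>\<^sub>0\<^sup>\<infinity> exp (- s\<^sup>2/2 - i s w) ds\<close> (\<open>half_gaussian\<close>).

  On the ray \<open>\<zeta> = z + t \<omega>\<close> the exponent is \<open>-i \<zeta>\<^sup>2 = -i z\<^sup>2 - t\<^sup>2 - i sqrt 2 t w\<close>, so the substitution
  \<open>s = sqrt 2 t\<close> gives \<open>B(z) = exp (-i z\<^sup>2) (\<omega> / sqrt 2) H(w)\<close> (\<open>B_eq_half_gaussian\<close>).

  For \<open>Im w < 0\<close> the kernel is a Laplace transform,
  \<open>1 / (x + w) = i \<integral>\<^sub>0\<^sup>\<infinity> exp (-i s (x + w)) ds\<close>. Fubini's theorem and the Fourier transform of the
  Gaussian turn the integral in \<open>K0_hat\<close> into \<open>i sqrt (2 \<pi>) H(w)\<close>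
  (\<open>gaussian_cauchy_transform_lower\<close>), which is the first case of the formula. For \<open>Im w > 0\<close> the
  reflection \<open>x \<mapsto> -x\<close> gives \<open>-i sqrt (2 \<pi>) H(-w)\<close> instead, and the extra term of the second case
  comes from \<open>H(w) + H(-w)\<close>, which is the full Gaussian integral
  \<open>sqrt (2 \<pi>) exp (- w\<^sup>2/2) = sqrt (2 \<pi>) exp (i z\<^sup>2)\<close> (\<open>half_gaussian_reflect\<close>).
\<close>

section \<open>The Fourier transform of the Gaussian at a complex frequency\<close>

lemma gaussian_fourier_real:
  fixes a :: real
  shows "has_bochner_integral lborel (\<lambda>s::real. exp (- (of_real s)\<^sup>2 / 2 - \<i> * of_real s * of_real a))
           (of_real (sqrt (2 * pi)) * exp (- (of_real a)\<^sup>2 / 2 :: complex))"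
proof -
  let ?f = "\<lambda>s::real. exp (- (of_real s)\<^sup>2 / 2 - \<i> * of_real s * of_real a) :: complex"
  have eq: "?f s = of_real (sqrt (2 * pi)) * (std_normal_density s *\<^sub>R iexp (- a * s))" for s
  proof -
    have "?f s = exp (of_real (- s\<^sup>2 / 2)) * iexp (- a * s)"
      unfolding exp_add [symmetric] by (simp add: mult_ac)
    then show ?thesis
      unfolding exp_of_real by (simp add: std_normal_density_def scaleR_conv_of_real)
  qed
  have int: "integrable lborel (\<lambda>s. std_normal_density s *\<^sub>R iexp (- a * s))"
    by (rule Bochner_Integration.integrable_bound [OF integrable_normal_density [of 1 0]])
       (auto simp: norm_mult)
  have "(LINT s|lborel. std_normal_density s *\<^sub>R iexp (- a * s)) = char std_normal_distribution (- a)"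
    unfolding char_def by (subst integral_density) auto
  also have "\<dots> = exp (- (of_real a)\<^sup>2 / 2)"
    by (simp add: char_std_normal_distribution exp_of_real [symmetric] del: exp_of_real)
  finally have "has_bochner_integral lborel (\<lambda>s. std_normal_density s *\<^sub>R iexp (- a * s))
      (exp (- (of_real a)\<^sup>2 / 2))"
    using int by (simp add: has_bochner_integral_iff)
  from has_bochner_integral_mult_right [OF this, of "of_real (sqrt (2 * pi))"]
  show ?thesis unfolding eq by simp
qed

text \<open>The imaginary part of \<open>w\<close> only shifts the Gaussian along the real axis, so no deformation of
  the contour is needed to pass from real to complex frequencies.\<close>

lemma gaussian_fourier:
  fixes w :: complex
  shows "has_bochner_integral lborel (\<lambda>s::real. exp (- (of_real s)\<^sup>2 / 2 - \<i> * of_real s * w))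
           (of_real (sqrt (2 * pi)) * exp (- w\<^sup>2 / 2))"
proof -
  define a b where "a = Re w" and "b = Im w"
  have w: "w = of_real a + \<i> * of_real b"
    by (simp add: a_def b_def complex_eq)
  \<comment> \<open>\<open>exp (b\<^sup>2/2)\<close> comes from completing the square in \<open>- s\<^sup>2/2 + b s\<close>, the phase from shifting
    \<open>exp (- i a s)\<close> by \<open>b\<close>\<close>
  define C :: complex where "C = exp ((of_real b)\<^sup>2 / 2 - \<i> * of_real a * of_real b)"
  let ?f = "\<lambda>s::real. exp (- (of_real s)\<^sup>2 / 2 - \<i> * of_real s * of_real a) :: complex"
  have "has_bochner_integral lborel (\<lambda>s. ?f (- b + 1 * s))
      (of_real (sqrt (2 * pi)) * exp (- (of_real a)\<^sup>2 / 2 :: complex))"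
    using gaussian_fourier_real [of a]
    by (subst (asm) lborel_has_bochner_integral_real_affine_iff [of 1 _ _ "- b"]) simp_all
  from has_bochner_integral_mult_right [OF this, of C]
  have "has_bochner_integral lborel (\<lambda>s. C * ?f (- b + 1 * s))
      (C * (of_real (sqrt (2 * pi)) * exp (- (of_real a)\<^sup>2 / 2)))" by simp
  also have "(\<lambda>s. C * ?f (- b + 1 * s)) = (\<lambda>s::real. exp (- (of_real s)\<^sup>2 / 2 - \<i> * of_real s * w))"
    unfolding C_def exp_add [symmetric] w
    by (intro ext arg_cong [where f = exp]) (simp add: field_simps power2_eq_square)
  also have "C * (of_real (sqrt (2 * pi)) * exp (- (of_real a)\<^sup>2 / 2)) =
      of_real (sqrt (2 * pi)) * (C * exp (- (of_real a)\<^sup>2 / 2))" by simp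
  also have "C * exp (- (of_real a)\<^sup>2 / 2) = exp (- w\<^sup>2 / 2)"
    unfolding C_def exp_add [symmetric] w
    by (intro arg_cong [where f = exp]) (simp add: field_simps power2_eq_square)
  finally show ?thesis .
qed

section \<open>The half-line Gaussian integral\<close>

text \<open>The Gaussian Fourier integral restricted to the positive half-line; it converges absolutely
  for every complex \<open>w\<close>. In terms of the error function it is
  \<open>sqrt (\<pi>/2) exp (- w\<^sup>2/2) erfc (i w / sqrt 2)\<close>.\<close>

definition half_gaussian :: "complex \<Rightarrow> complex" where
  "half_gaussian w = (LINT s:{0..}|lborel. exp (- (of_real s)\<^sup>2 / 2 - \<i> * of_real s * w))"

lemma half_gaussian_integrable:
  "set_integrable lborel {0..} (\<lambda>s::real. exp (- (of_real s)\<^sup>2 / 2 - \<i> * of_real s * w))"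
  using gaussian_fourier [of w] unfolding set_integrable_def has_bochner_integral_iff
  by (intro integrable_mult_indicator) auto

lemma half_gaussian_reflect:
  "half_gaussian w + half_gaussian (- w) = of_real (sqrt (2 * pi)) * exp (- w\<^sup>2 / 2)"
proof -
  let ?f = "\<lambda>s::real. exp (- (of_real s)\<^sup>2 / 2 - \<i> * of_real s * w)"
  have int: "integrable lborel ?f"
    and val: "integral\<^sup>L lborel ?f = of_real (sqrt (2 * pi)) * exp (- w\<^sup>2 / 2)"
    using gaussian_fourier [of w] by (simp_all add: has_bochner_integral_iff)
  have sub: "set_integrable lborel A ?f" if "A \<in> sets lborel" for A
    unfolding set_integrable_def by (intro integrable_mult_indicator that int)
  have "half_gaussian (- w) = (LINT s:{..0}|lborel. ?f s)"
    unfolding half_gaussian_def set_lebesgue_integral_def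
    by (subst lborel_integral_real_affine [of "-1" _ 0])
       (auto intro!: Bochner_Integration.integral_cong simp: indicator_def)
  also have "\<dots> = (LINT s:{..<0}|lborel. ?f s)"
    unfolding set_lebesgue_integral_def
  proof (rule integral_cong_AE)
    show "AE s in lborel. indicator {..0} s *\<^sub>R ?f s = indicator {..<0} s *\<^sub>R ?f s"
      using AE_lborel_singleton [of "0::real"] by eventually_elim (auto simp: indicator_def)
  qed simp_all
  finally have "half_gaussian w + half_gaussian (- w) =
      (LINT s:{0..}|lborel. ?f s) + (LINT s:{..<0}|lborel. ?f s)"
    by (simp add: half_gaussian_def)
  also have "\<dots> = (LINT s:{0..} \<union> {..<0}|lborel. ?f s)"
    by (rule set_integral_Un [OF _ sub sub, symmetric]) auto
  also have "{0..} \<union> {..<0} = (UNIV :: real set)" by auto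
  finally show ?thesis using val by (simp add: set_lebesgue_integral_def)
qed

section \<open>The Cauchy transform of the Gaussian\<close>

lemma exp_half_line_integral:
  fixes c :: complex
  assumes "Re c > 0"
  shows "set_integrable lborel {0..} (\<lambda>s::real. exp (- of_real s * c))"
    and "(LINT s:{0..}|lborel. exp (- of_real s * c)) = 1 / c"
proof -
  have "set_integrable lebesgue {0..} (\<lambda>s::real. exp (- Re c * s))"
    using integrable_on_exp_minus_to_infinity [OF assms, of 0]
    by (intro nonnegative_absolutely_integrable_1) auto
  then have "integrable lborel (\<lambda>s::real. indicator {0..} s *\<^sub>R exp (- Re c * s))"
    unfolding set_integrable_def by (subst (asm) integrable_completion) auto
  then show int: "set_integrable lborel {0..} (\<lambda>s::real. exp (- of_real s * c))"
    unfolding set_integrable_def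
    by (rule Bochner_Integration.integrable_bound) (auto simp: indicator_def mult.commute)
  have c: "c \<noteq> 0" using assms by auto
  have lim: "((\<lambda>R. LINT s:{0..R}|lborel. exp (- of_real s * c)) \<longlongrightarrow>
         (LINT s:{0..}|lborel. exp (- of_real s * c))) at_top"
    by (rule tendsto_set_lebesgue_integral_at_top [OF _ int]) auto
  have fin: "(LINT s:{0..R}|lborel. exp (- of_real s * c)) = 1 / c - exp (- of_real R * c) / c"
    if "R \<ge> 0" for R
    unfolding set_lebesgue_integral_def
    using c that
    by (subst integral_FTC_Icc [where F = "\<lambda>s. - exp (- of_real s * c) / c"])
       (auto intro!: derivative_eq_intros continuous_intros has_vector_derivative_real_field)
  have "((\<lambda>R. exp (- R * Re c)) \<longlongrightarrow> 0) at_top"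
    using assms by real_asymp
  then have "((\<lambda>R. exp (- of_real R * c)) \<longlongrightarrow> 0) at_top"
    by (subst tendsto_norm_zero_iff [symmetric]) simp
  then have "((\<lambda>R. 1 / c - exp (- of_real R * c) / c) \<longlongrightarrow> 1 / c - 0 / c) at_top"
    by (intro tendsto_intros c)
  then have "((\<lambda>R. 1 / c - exp (- of_real R * c) / c) \<longlongrightarrow> 1 / c) at_top"
    by simp
  then have "((\<lambda>R. LINT s:{0..R}|lborel. exp (- of_real s * c)) \<longlongrightarrow> 1 / c) at_top"
    by (rule Lim_transform_eventually)
       (rule eventually_mono [OF eventually_ge_at_top [of 0]], rule fin [symmetric])
  with lim show "(LINT s:{0..}|lborel. exp (- of_real s * c)) = 1 / c"
    by (rule tendsto_unique [OF trivial_limit_at_top_linorder])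
qed

lemma gaussian_cauchy_transform_lower:
  fixes w :: complex
  assumes "Im w < 0"
  shows "(LINT x|lborel. of_real (exp (- (1 / 2) * x\<^sup>2)) / (of_real x + w)) =
           \<i> * of_real (sqrt (2 * pi)) * half_gaussian w"
proof -
  \<comment> \<open>integrating \<open>f x s\<close> over \<open>s\<close> gives the Cauchy kernel, integrating over \<open>x\<close> a Fourier transform\<close>
  define f :: "real \<Rightarrow> real \<Rightarrow> complex" where
    "f x s = exp (- (of_real x)\<^sup>2 / 2) * (indicator {0..} s *\<^sub>R exp (- of_real s * (\<i> * (of_real x + w))))"
    for x s
  have re: "Re (\<i> * (of_real x + w)) > 0" for x using assms by simp
  have gauss: "integrable lborel (\<lambda>x::real. exp (- (of_real x)\<^sup>2 / 2) :: complex)"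
    using gaussian_fourier [of 0] by (simp add: has_bochner_integral_iff)
  have intf: "integrable (lborel \<Otimes>\<^sub>M lborel) (case_prod f)"
  proof (rule lborel_pair.Fubini_integrable)
    show "case_prod f \<in> borel_measurable (lborel \<Otimes>\<^sub>M lborel)"
      unfolding f_def by measurable
    have "norm (f x s) = norm (exp (- (of_real x)\<^sup>2 / 2) :: complex) * (indicator {0..} s * exp (s * Im w))" for x s
      by (simp add: f_def norm_mult indicator_def)
    then show "integrable lborel (\<lambda>x. \<integral>s. norm (case (x, s) of (x, s) \<Rightarrow> f x s) \<partial>lborel)"
      using integrable_norm [OF gauss] by simp
    have "integrable lborel (f x)" for x
      using exp_half_line_integral(1) [OF re [of x]] unfolding f_def set_integrable_def
      by (intro integrable_mult_right)
    then show "AE x in lborel. integrable lborel (\<lambda>s. case (x, s) of (x, s) \<Rightarrow> f x s)"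
      by simp
  qed
  have inner_s: "(LINT s|lborel. f x s) = - \<i> * (of_real (exp (- (1 / 2) * x\<^sup>2)) / (of_real x + w))" for x
  proof -
    have "of_real x + w \<noteq> 0" using re [of x] by (metis less_irrefl mult_zero_right zero_complex.sel(1))
    have "(LINT s|lborel. f x s) = exp (- (of_real x)\<^sup>2 / 2) * (1 / (\<i> * (of_real x + w)))"
      using exp_half_line_integral(2) [OF re [of x]]
      unfolding f_def set_lebesgue_integral_def by (simp only: integral_mult_right_zero)
    also have "exp (- (of_real x)\<^sup>2 / 2) = (of_real (exp (- (1 / 2) * x\<^sup>2)) :: complex)"
      by (simp flip: exp_of_real)
    also have "\<dots> * (1 / (\<i> * (of_real x + w))) = - \<i> * (\<dots> / (of_real x + w))"
      using \<open>of_real x + w \<noteq> 0\<close> by (simp add: divide_simps)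
    finally show ?thesis .
  qed
  have inner_x: "(LINT x|lborel. f x s) =
      of_real (sqrt (2 * pi)) * (indicator {0..} s *\<^sub>R exp (- (of_real s)\<^sup>2 / 2 - \<i> * of_real s * w))" for s
  proof -
    have "f x s = (indicator {0..} s *\<^sub>R exp (- \<i> * of_real s * w)) *
                    exp (- (of_real x)\<^sup>2 / 2 - \<i> * of_real x * of_real s)" for x
      by (simp add: f_def indicator_def exp_add [symmetric] algebra_simps)
    then have "(LINT x|lborel. f x s) = (indicator {0..} s *\<^sub>R exp (- \<i> * of_real s * w)) *
        (of_real (sqrt (2 * pi)) * exp (- (of_real s)\<^sup>2 / 2))"
      using gaussian_fourier_real [of s] by (simp add: has_bochner_integral_iff)
    moreover have "exp (- (of_real s)\<^sup>2 / 2 - \<i> * of_real s * w) =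
        exp (- \<i> * of_real s * w) * exp (- (of_real s)\<^sup>2 / 2)"
      unfolding exp_add [symmetric] by (rule arg_cong [where f = exp]) simp
    ultimately show ?thesis by simp
  qed
  have "(LINT x|lborel. LINT s|lborel. f x s) = (LINT s|lborel. LINT x|lborel. f x s)"
    using lborel_pair.Fubini_integral [OF intf] by simp
  then have "- \<i> * (LINT x|lborel. of_real (exp (- (1 / 2) * x\<^sup>2)) / (of_real x + w)) =
      of_real (sqrt (2 * pi)) * half_gaussian w"
    unfolding inner_s inner_x half_gaussian_def set_lebesgue_integral_def
    by (simp only: integral_mult_right_zero)
  then have "\<i> * (- \<i> * (LINT x|lborel. of_real (exp (- (1 / 2) * x\<^sup>2)) / (of_real x + w))) =
      \<i> * (of_real (sqrt (2 * pi)) * half_gaussian w)" by (rule arg_cong)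
  then show ?thesis by (simp add: mult.assoc [symmetric])
qed

lemma gaussian_cauchy_transform_upper:
  fixes w :: complex
  assumes "Im w > 0"
  shows "(LINT x|lborel. of_real (exp (- (1 / 2) * x\<^sup>2)) / (of_real x + w)) =
           - \<i> * of_real (sqrt (2 * pi)) * half_gaussian (- w)"
proof -
  let ?g = "\<lambda>x::real. of_real (exp (- (1 / 2) * x\<^sup>2)) / (of_real x + w)"
  have "(LINT x|lborel. ?g x) = (LINT x|lborel. ?g (- x))"
    using lborel_integral_real_affine [of "-1" ?g 0] by simp
  also have "(\<lambda>x. ?g (- x)) = (\<lambda>x. - (of_real (exp (- (1 / 2) * x\<^sup>2)) / (of_real x + - w)))"
  proof
    fix x :: real
    have "of_real (- x) + w = - (of_real x + - w)" by simp
    then show "?g (- x) = - (of_real (exp (- (1 / 2) * x\<^sup>2)) / (of_real x + - w))"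
      by (simp only: divide_minus_right power2_minus)
  qed
  also have "integral\<^sup>L lborel \<dots> = - (LINT x|lborel. of_real (exp (- (1 / 2) * x\<^sup>2)) / (of_real x + - w))"
    by (rule integral_minus)
  also have "\<dots> = - (\<i> * of_real (sqrt (2 * pi)) * half_gaussian (- w))"
    using assms by (subst gaussian_cauchy_transform_lower) auto
  finally show ?thesis by simp
qed

section \<open>Integrals along a ray\<close>

lemma contour_integral_segment_of_ray:
  fixes f :: "complex \<Rightarrow> complex"
  assumes "continuous_on UNIV f" "R > 0"
  shows "contour_integral (linepath z (z + of_real R * d)) f =
           integral {0..R} (\<lambda>t. f (z + of_real t * d) * d)"
proof (rule contour_integral_unique)
  let ?g = "\<lambda>t. f (z + of_real t * d) * d"
  have "continuous_on {0..R} ?g"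
    by (intro continuous_intros continuous_on_compose2 [OF assms(1)]) auto
  then have "(?g has_integral integral {0..R} ?g) {0..R}"
    by (intro integrable_integral integrable_continuous_real)
  then have "((\<lambda>x. ?g (R * x)) has_integral (1 / R) *\<^sub>R integral {0..R} ?g) ((\<lambda>x. x / R) ` {0..R})"
    using has_integral_stretch_real [of ?g _ 0 R R] assms(2) by simp
  also have "(\<lambda>x. x / R) ` {0..R} = {0..1}"
    using assms(2) by simp
  finally have "((\<lambda>x. R *\<^sub>R ?g (R * x)) has_integral R *\<^sub>R ((1 / R) *\<^sub>R integral {0..R} ?g)) {0..1}"
    by (rule has_integral_cmul)
  moreover have "R *\<^sub>R ?g (R * x) = f (linepath z (z + of_real R * d) x) * (z + of_real R * d - z)" for x
    by (simp add: linepath_def scaleR_conv_of_real algebra_simps)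
  ultimately show "(f has_contour_integral integral {0..R} ?g) (linepath z (z + of_real R * d))"
    using assms(2) by (simp add: has_contour_integral_linepath)
qed

text \<open>Absolute convergence on the half-line makes the limit that defines the improper contour
  integral exist and equal the Lebesgue integral.\<close>

lemma ray_integral_eq_lebesgue:
  fixes f :: "complex \<Rightarrow> complex"
  assumes "continuous_on UNIV f"
    and int: "set_integrable lborel {0..} (\<lambda>t. f (z + of_real t * d) * d)"
  shows "ray_integral f z d = (LINT t:{0..}|lborel. f (z + of_real t * d) * d)"
  unfolding ray_integral_def
proof (rule tendsto_Lim [OF trivial_limit_at_top_linorder])
  let ?g = "\<lambda>t. f (z + of_real t * d) * d"
  have "((\<lambda>R. LINT t:{0..R}|lborel. ?g t) \<longlongrightarrow> (LINT t:{0..}|lborel. ?g t)) at_top"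
    by (rule tendsto_set_lebesgue_integral_at_top [OF _ int]) auto
  moreover have "(LINT t:{0..R}|lborel. ?g t) = contour_integral (linepath z (z + of_real R * d)) f"
    if "R > 0" for R
    using set_borel_integral_eq_integral(2) [OF set_integrable_subset [OF int, of "{0..R}"]]
      contour_integral_segment_of_ray [OF assms(1) that, of z d] by auto
  ultimately show "((\<lambda>R. contour_integral (linepath z (z + of_real R * d)) f) \<longlongrightarrow>
      (LINT t:{0..}|lborel. ?g t)) at_top"
    by (elim Lim_transform_eventually) (auto intro!: eventually_mono [OF eventually_gt_at_top [of 0]])
qed

section \<open>The two representations\<close>

lemma exp_minus_i_pi_4_squared: "(exp (- (\<i> * of_real pi / 4)))\<^sup>2 = - \<i>"
proof -
  have "(exp (- (\<i> * of_real pi / 4)))\<^sup>2 = exp (- (\<i> * of_real pi / 2))"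
    unfolding exp_double [symmetric] by (simp add: algebra_simps)
  also have "exp (\<i> * of_real pi / 2) = \<i>"
    using cis_conv_exp [of "pi / 2"] by simp
  then have "exp (- (\<i> * of_real pi / 2)) = - \<i>" by (simp add: exp_minus)
  finally show ?thesis .
qed

lemma B_eq_half_gaussian:
  fixes z :: complex
  defines "\<omega> \<equiv> exp (- (\<i> * of_real pi / 4))"
  shows "B z = exp (- \<i> * z\<^sup>2) * (\<omega> / of_real (sqrt 2)) * half_gaussian (of_real (sqrt 2) * \<omega> * z)"
proof -
  define w where "w = of_real (sqrt 2) * \<omega> * z"
  define h where "h s = indicator {0..} s *\<^sub>R exp (- (of_real s)\<^sup>2 / 2 - \<i> * of_real s * w)" for s :: real
  let ?g = "\<lambda>t::real. exp (- \<i> * (z + of_real t * \<omega>)\<^sup>2) * \<omega>"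
  have r2: "of_real (sqrt 2) * of_real (sqrt 2) = (2 :: complex)"
    by (simp flip: of_real_mult)
  have om: "\<omega>\<^sup>2 = - \<i>" unfolding \<omega>_def by (rule exp_minus_i_pi_4_squared)
  have expo: "- \<i> * (z + of_real t * \<omega>)\<^sup>2 =
      - \<i> * z\<^sup>2 + (- (of_real (sqrt 2 * t))\<^sup>2 / 2 - \<i> * of_real (sqrt 2 * t) * w)" for t
  proof -
    have "- \<i> * (z + of_real t * \<omega>)\<^sup>2 = - \<i> * z\<^sup>2 - \<i> * (of_real t)\<^sup>2 * \<omega>\<^sup>2 - \<i> * (2 * of_real t * \<omega> * z)"
      by (simp add: power2_eq_square algebra_simps)
    also have "\<dots> = - \<i> * z\<^sup>2 - (of_real t)\<^sup>2 - \<i> * (2 * of_real t * \<omega> * z)"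
      by (simp add: om mult_ac)
    also have "2 * of_real t * \<omega> * z = of_real (sqrt 2 * t) * w"
      using r2 by (simp add: w_def)
    also have "(of_real t)\<^sup>2 = (of_real (sqrt 2 * t))\<^sup>2 / (2 :: complex)"
      using r2 by (simp add: power2_eq_square)
    finally show ?thesis by (simp add: algebra_simps)
  qed
  have g: "indicator {0..} t *\<^sub>R ?g t = exp (- \<i> * z\<^sup>2) * \<omega> * h (0 + sqrt 2 * t)" for t
    unfolding expo exp_add by (simp add: h_def indicator_def zero_le_mult_iff)
  have "has_bochner_integral lborel h (half_gaussian w)"
    using half_gaussian_integrable [of w]
    unfolding h_def half_gaussian_def set_integrable_def set_lebesgue_integral_def
    by (simp add: has_bochner_integral_iff)
  then have "has_bochner_integral lborel (\<lambda>t. h (0 + sqrt 2 * t)) (half_gaussian w /\<^sub>R \<bar>sqrt 2\<bar>)"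
    by (subst (asm) lborel_has_bochner_integral_real_affine_iff [of "sqrt 2" _ _ 0]) simp_all
  then have "has_bochner_integral lborel (\<lambda>t. indicator {0..} t *\<^sub>R ?g t)
      (exp (- \<i> * z\<^sup>2) * \<omega> * (half_gaussian w /\<^sub>R \<bar>sqrt 2\<bar>))"
    unfolding g by (rule has_bochner_integral_mult_right)
  then have "set_integrable lborel {0..} ?g"
    and "(LINT t:{0..}|lborel. ?g t) = exp (- \<i> * z\<^sup>2) * \<omega> * (half_gaussian w /\<^sub>R \<bar>sqrt 2\<bar>)"
    unfolding set_integrable_def set_lebesgue_integral_def has_bochner_integral_iff by blast+
  moreover have "continuous_on UNIV (\<lambda>\<zeta>::complex. exp (- \<i> * \<zeta>\<^sup>2))"
    by (intro continuous_intros)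
  ultimately show ?thesis
    unfolding B_def \<omega>_def [symmetric] w_def [symmetric]
    by (simp add: ray_integral_eq_lebesgue scaleR_conv_of_real field_simps)
qed

theorem lemma4p1:
  fixes z :: complex
  shows "(Im (exp (- (\<i> * of_real pi / 4)) * z) < 0 \<longrightarrow>
            B z = exp (- \<i> * z\<^sup>2) * K0_hat z) \<and>
         (Im (exp (- (\<i> * of_real pi / 4)) * z) > 0 \<longrightarrow>
            B z = exp (- \<i> * z\<^sup>2) * K0_hat z
                  + of_real (sqrt pi) * exp (- (\<i> * of_real pi / 4)))"
proof -
  define \<omega> where "\<omega> = exp (- (\<i> * of_real pi / 4))"
  define w where "w = of_real (sqrt 2) * \<omega> * z"
  define c where "c = \<omega> / of_real (sqrt 2)"
  have Bz: "B z = exp (- \<i> * z\<^sup>2) * c * half_gaussian w"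
    unfolding B_eq_half_gaussian c_def w_def \<omega>_def ..
  have om: "\<omega>\<^sup>2 = - \<i>" unfolding \<omega>_def by (rule exp_minus_i_pi_4_squared)
  have "\<omega> * exp (\<i> * of_real pi / 4) = 1"
    by (simp add: \<omega>_def flip: exp_add)
  moreover have "\<omega> * (\<i> * \<omega>) = 1"
    using om by (simp add: power2_eq_square mult.left_commute)
  moreover have "\<omega> \<noteq> 0" by (simp add: \<omega>_def)
  ultimately have inv: "exp (\<i> * of_real pi / 4) = \<i> * \<omega>"
    by (metis mult_cancel_left)
  have r2: "of_real (sqrt 2) * of_real (sqrt 2) = (2 :: complex)"
    by (simp flip: of_real_mult)
  have coef: "- (exp (\<i> * of_real pi / 4) / (2 * of_real (sqrt pi))) * (\<i> * of_real (sqrt (2 * pi))) = c"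
    using r2 by (simp add: inv c_def real_sqrt_mult field_simps)
  have K: "K0_hat z = - (exp (\<i> * of_real pi / 4) / (2 * of_real (sqrt pi))) *
     (LINT x|lborel. of_real (exp (- (1 / 2) * x\<^sup>2)) / (of_real x + w))"
    by (simp add: K0_hat_def w_def \<omega>_def mult.commute [of \<i>])
  have Imw: "Im w = sqrt 2 * Im (\<omega> * z)"
    by (simp add: w_def mult.assoc)
  have "B z = exp (- \<i> * z\<^sup>2) * K0_hat z" if "Im (\<omega> * z) < 0"
  proof -
    have "Im w < 0" using that by (simp add: Imw mult_pos_neg)
    then have "K0_hat z = c * half_gaussian w"
      unfolding K gaussian_cauchy_transform_lower [OF \<open>Im w < 0\<close>] coef [symmetric] by (simp only: mult.assoc)
    then show ?thesis by (simp add: Bz)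
  qed
  moreover have "B z = exp (- \<i> * z\<^sup>2) * K0_hat z + of_real (sqrt pi) * \<omega>" if "Im (\<omega> * z) > 0"
  proof -
    have "Im w > 0" using that by (simp add: Imw)
    then have "K0_hat z = - c * half_gaussian (- w)"
      unfolding K gaussian_cauchy_transform_upper [OF \<open>Im w > 0\<close>] coef [symmetric] by simp
    then have "B z - exp (- \<i> * z\<^sup>2) * K0_hat z = exp (- \<i> * z\<^sup>2) * c * (half_gaussian w + half_gaussian (- w))"
      by (simp add: Bz algebra_simps)
    also have "\<dots> = (c * of_real (sqrt (2 * pi))) * (exp (- \<i> * z\<^sup>2) * exp (- w\<^sup>2 / 2))"
      by (simp add: half_gaussian_reflect)
    also have "- w\<^sup>2 / 2 = \<i> * z\<^sup>2"
    proof -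
      have "w\<^sup>2 = (of_real (sqrt 2) * of_real (sqrt 2)) * \<omega>\<^sup>2 * z\<^sup>2"
        by (simp add: w_def power2_eq_square)
      then show ?thesis unfolding r2 om by simp
    qed
    also have "exp (- \<i> * z\<^sup>2) * exp (\<i> * z\<^sup>2) = 1"
      by (simp flip: exp_add)
    also have "c * of_real (sqrt (2 * pi)) = of_real (sqrt pi) * \<omega>"
      by (simp add: c_def real_sqrt_mult)
    finally show ?thesis by (simp add: algebra_simps)
  qed
  ultimately show ?thesis by (simp add: \<omega>_def)
qed

end
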